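(* Let $p$ be an odd prime which is not a Mersenne prime. Then, for any even integer $d$ with $p\le d\le 2(p-1)$, there exists a GAPN binomial over $\mathbb{F}_{p^2}$ of algebraic degree $d$.
   Context: $\mathbb{F}_{p^n}$ denotes the finite field with $p^n$ elements and $\mathbb{F}_{p^n}^*$ its multiplicative group. A Mersenne prime is a prime of the form $2^m-1$ with $m$ a natural number. A function $G\colon\mathbb{F}_{p^n}\to\mathbb{F}_{p^n}$ is GAPN (generalized almost perfect nonlinear) if for all $a\in\mathbb{F}_{p^n}^*$ and $b\in\mathbb{F}_{p^n}$ the equation $\sum_{i\in\mathbb{F}_p}G(X+ia)=b$ has at most $p$ solutions $X\in\mathbb{F}_{p^n}$. For a non-negative integer $u$ with base-$p$ representation $u=\sum_{i\ge 0}h_ip^i$, put $d_p(u)=\sum_{i\ge0}h_i$. The algebraic degree of a nonzero function $G(X)=\sum_{u=0}^{p^n-1}a_uX^u$ (the unique such representation of degree at most $p^n-1$, with $a_u\in\mathbb{F}_{p^n}$) is the maximum of $d_p(u)$ over all $u\in\{0,\dots,p^n-1\}$ with $a_u\ne0$. A binomial over $\mathbb{F}_{p^2}$ is a function $\mathbb{F}_{p^2}\to\mathbb{F}_{p^2}$ whose representation $\sum_{u=0}^{p^2-1}a_uX^u$ has exactly two nonzero coefficients $a_u$. *)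

theory Defs
  imports "HOL-Computational_Algebra.Computational_Algebra" "HOL-Library.Cardinality"
begin

definition mersenne_prime :: "nat \<Rightarrow> bool" where
  "mersenne_prime p \<longleftrightarrow> prime p \<and> (\<exists>m::nat. p = 2 ^ m - 1)"

text \<open>
  A finite field with $p^n$ elements is a type of sort \<open>{field, finite}\<close> with cardinality
  $p^n$. Its prime subfield consists of the elements \<open>of_nat i\<close> with \<open>i < p\<close>,
  which are pairwise distinct.
\<close>

definition gapn :: "nat \<Rightarrow> ('a::{field, finite} \<Rightarrow> 'a) \<Rightarrow> bool" where
  "gapn p G \<longleftrightarrow>
     (\<forall>a b. a \<noteq> 0 \<longrightarrow> card {X. (\<Sum>i<p. G (X + of_nat i * a)) = b} \<le> p)"

text \<open>For \<open>p \<ge> 2\<close> all digits of \<open>u\<close> at positions beyond \<open>u\<close> vanish, as $u < p^u$.\<close>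

definition digit_sum :: "nat \<Rightarrow> nat \<Rightarrow> nat" where
  "digit_sum p u = (\<Sum>i\<le>u. u div p ^ i mod p)"

definition fun_poly :: "('a::{field, finite} \<Rightarrow> 'a) \<Rightarrow> 'a poly" where
  "fun_poly G = (THE P. degree P \<le> CARD('a) - 1 \<and> (\<forall>x. poly P x = G x))"

lemma ex1_fun_poly:
  fixes G :: "'a::{field, finite} \<Rightarrow> 'a"
  shows "\<exists>!P. degree P \<le> CARD('a) - 1 \<and> (\<forall>x. poly P x = G x)"
proof (rule ex_ex1I)
  define L where "L a = (\<Prod>b\<in>-{a}. [:- b, 1:])" for a :: 'a
  define P where "P = (\<Sum>a\<in>UNIV. smult (G a / poly (L a) a) (L a))"
  have deg: "degree (L a) \<le> CARD('a) - 1" for a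
    using degree_prod_sum_le[of "-{a}" "\<lambda>b. [:- b, 1:]"]
    by (simp add: L_def o_def Compl_eq_Diff_UNIV)
  have L0: "poly (L a) x = 0" if "x \<noteq> a" for a x
    using that by (auto simp: L_def poly_prod)
  have L1: "poly (L a) a \<noteq> 0" for a
    by (auto simp: L_def poly_prod)
  have "degree P \<le> CARD('a) - 1"
    unfolding P_def by (intro degree_sum_le order_trans[OF degree_smult_le deg]) simp
  moreover have "poly P x = G x" for x
  proof -
    have "poly P x = (\<Sum>a\<in>UNIV. if a = x then G x else 0)"
      unfolding P_def poly_sum by (rule sum.cong) (auto simp: L0 L1)
    thus ?thesis by simp
  qed
  ultimately show "\<exists>P. degree P \<le> CARD('a) - 1 \<and> (\<forall>x. poly P x = G x)"
    by blast
next
  fix P Q :: "'a poly"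
  assume P: "degree P \<le> CARD('a) - 1 \<and> (\<forall>x. poly P x = G x)"
    and Q: "degree Q \<le> CARD('a) - 1 \<and> (\<forall>x. poly Q x = G x)"
  have "CARD('a) > 0" by simp
  with P Q have "degree P < CARD('a)" "degree Q < CARD('a)" by linarith+
  thus "P = Q"
    by (intro poly_eqI_degree[of UNIV]) (use P Q in simp_all)
qed

definition poly_exponents :: "('a::{field, finite} \<Rightarrow> 'a) \<Rightarrow> nat set" where
  "poly_exponents G = {u. coeff (fun_poly G) u \<noteq> 0}"

text \<open>Only meaningful for nonzero \<open>G\<close>.\<close>

definition algebraic_degree :: "nat \<Rightarrow> ('a::{field, finite} \<Rightarrow> 'a) \<Rightarrow> nat" where
  "algebraic_degree p G = Max (digit_sum p ` poly_exponents G)"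

definition is_binomial :: "('a::{field, finite} \<Rightarrow> 'a) \<Rightarrow> bool" where
  "is_binomial G \<longleftrightarrow> card (poly_exponents G) = 2"

end

theory Submission
  imports Defs
begin

text \<open>
  Write $d = p - 1 + e$ with $e$ even and take $G(X) = X^u + cX^v$ with $u = (p-1) + ep$ and
  $v = k + (p-k)p$. Substituting $X = aY$ and $Z = Y^p - Y$, the sum of $G(X + ia)$ over
  $i \in \mathbb{F}_p$ equals, up to a constant independent of $Y$,
  $-(a^u Z^e - k c a^v Z)$. Here $Z^p = -Z$, so $Z^e \in \mathbb{F}_p$, and if two values of $Z$
  collide then $c a^{v-u}$ is a product of an element of $\mathbb{F}_p^*$ and the inverse of
  some $W$ with $W^{p-1} = -1$. Since $p + 1$ is not a power of 2, it has an odd divisor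
  $r > 1$, and $k$ can be chosen such that $r$ divides $v - u$. Then all factors apart from $c$ are
  killed by the power $N = (p^2 - 1)/r$, so any $c \neq 0$ with $c^N \neq 1$ makes $Z$ unique, and
  at most $p$ values of $Y$ share the same $Z$.
\<close>

section \<open>Finite fields and their prime subfield\<close>

lemma power_card_minus_1_eq_1:
  fixes x :: "'a::{field, finite}"
  assumes "x \<noteq> 0"
  shows "x ^ (CARD('a) - 1) = 1"
proof -
  \<comment> \<open>Multiplication by \<open>x\<close> permutes the nonzero elements, and their
    product can be cancelled.\<close>
  have "(\<Prod>y\<in>UNIV-{0}. y) = (\<Prod>y\<in>UNIV-{0}. x * y)"
    by (rule prod.reindex_bij_witness[of _ "\<lambda>y. x * y" "\<lambda>y. y / x"]) (use assms in auto)
  also have "\<dots> = x ^ (CARD('a) - 1) * (\<Prod>y\<in>UNIV-{0}. y)"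
    by (simp add: prod.distrib)
  finally show ?thesis by simp
qed

lemma CHAR_eq_if_card_eq_prime_power:
  assumes "prime p" "CARD('a::{field, finite}) = p ^ n"
  shows "CHAR('a) = p"
proof -
  have "prime CHAR('a)"
    by (rule prime_CHAR_semidom) (simp add: finite_imp_CHAR_pos)
  moreover have "CHAR('a) dvd p ^ n"
  proof -
    \<comment> \<open>The shift by 1 permutes the field, so \<open>CARD('a)\<close> copies of 1 add
      up to 0.\<close>
    have "(\<Sum>y\<in>UNIV. y) = (\<Sum>y\<in>UNIV. y + 1 :: 'a)"
      by (rule sum.reindex_bij_witness[of _ "\<lambda>y. y + 1" "\<lambda>y. y - 1"]) auto
    hence "of_nat CARD('a) = (0 :: 'a)" by (simp add: sum.distrib)
    thus ?thesis using assms(2) by (simp only: of_nat_eq_0_iff_char_dvd)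
  qed
  ultimately show ?thesis
    using assms(1) prime_dvd_power primes_dvd_imp_eq by blast
qed

lemma of_nat_power_CHAR:
  assumes "prime CHAR('a::comm_semiring_1)"
  shows "(of_nat i :: 'a) ^ CHAR('a) = of_nat i"
proof (induction i)
  case 0
  show ?case using prime_gt_0_nat[OF assms] by (simp add: power_0_left)
next
  case (Suc i)
  thus ?case by (simp add: freshmans_dream[OF assms])
qed

section \<open>Power sums over cosets of the prime field\<close>

text \<open>The factor \<open>p\<close> of \<open>fact n\<close> cannot cancel: \<open>p - 1\<close>
  and \<open>n - (p - 1)\<close> are both below \<open>p\<close>.\<close>

lemma prime_dvd_choose_pred:
  fixes p n :: nat
  assumes "prime p" "p \<le> n" "n \<le> 2 * p - 2"
  shows "p dvd (n choose (p - 1))"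
proof -
  have p: "p \<ge> 2" using assms(1) by (rule prime_ge_2_nat)
  have "fact (p - 1) * fact (n - (p - 1)) * (n choose (p - 1)) = (fact n :: nat)"
    by (rule binomial_fact_lemma) (use assms in simp)
  moreover have "p dvd fact n"
    using assms by (simp add: prime_dvd_fact_iff)
  moreover have "\<not> p dvd fact (p - 1)" "\<not> p dvd fact (n - (p - 1))"
    unfolding prime_dvd_fact_iff[OF assms(1)] using assms(2,3) p by linarith+
  ultimately show ?thesis
    using assms(1) by (metis prime_dvd_mult_iff)
qed

definition shifted_power_sum :: "nat \<Rightarrow> 'a::comm_ring_1 \<Rightarrow> nat \<Rightarrow> 'a" where
  "shifted_power_sum p x m = (\<Sum>i<p. (x + of_nat i) ^ m)"

text \<open>Summing the differences of consecutive powers \<open>(x + of_nat i) ^ Suc m\<close>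
  telescopes, and the two ends agree because \<open>p\<close> is 0 in the ring.\<close>

lemma shifted_power_sum_recurrence:
  fixes x :: "'a::comm_ring_1"
  assumes "of_nat p = (0 :: 'a)"
  shows "(\<Sum>j\<le>m. of_nat (Suc m choose j) * shifted_power_sum p x j) = 0"
proof -
  let ?f = "\<lambda>i. (x + of_nat i) ^ Suc m"
  have step: "?f (Suc i) - ?f i = (\<Sum>j\<le>m. of_nat (Suc m choose j) * (x + of_nat i) ^ j)" for i
  proof -
    have "?f (Suc i) = ((x + of_nat i) + 1) ^ Suc m"
      by (simp add: algebra_simps)
    also have "\<dots> = (\<Sum>j\<le>Suc m. of_nat (Suc m choose j) * (x + of_nat i) ^ j)"
      by (subst binomial_ring) simp
    finally show ?thesis by simp
  qed
  have "(\<Sum>j\<le>m. of_nat (Suc m choose j) * shifted_power_sum p x j)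
      = (\<Sum>i<p. \<Sum>j\<le>m. of_nat (Suc m choose j) * (x + of_nat i) ^ j)"
    unfolding shifted_power_sum_def sum_distrib_left by (rule sum.swap)
  also have "\<dots> = (\<Sum>i<p. ?f (Suc i) - ?f i)"
    by (simp only: step)
  also have "\<dots> = 0"
    by (subst sum_lessThan_telescope) (simp add: assms)
  finally show ?thesis .
qed

text \<open>The recurrence determines the sum for \<open>m\<close> from the lower ones, since
  \<open>Suc m\<close> is invertible: \<open>p\<close> is its only possible multiple of
  \<open>p\<close> in this range, and \<open>m \<noteq> p - 1\<close> excludes it. The lower sums
  vanish by induction, except for \<open>j = p - 1\<close>, whose coefficient is divisible by
  \<open>p\<close>.\<close>

lemma shifted_power_sum_eq_0:
  fixes x :: "'a::field"
  assumes "prime p" "CHAR('a) = p" "m < 2 * p - 2" "m \<noteq> p - 1"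
  shows "shifted_power_sum p x m = 0"
  using assms(3,4)
proof (induction m rule: less_induct)
  case (less m)
  have p: "p \<ge> 2" using assms(1) by (rule prime_ge_2_nat)
  have "of_nat (Suc m choose j) * shifted_power_sum p x j = 0" if "j < m" for j
  proof (cases "j = p - 1")
    case True
    hence "p dvd (Suc m choose j)"
      unfolding True by (intro prime_dvd_choose_pred assms(1)) (use True that less.prems in linarith)+
    thus ?thesis
      using assms(2) by (simp add: of_nat_eq_0_iff_char_dvd del: binomial_Suc_Suc)
  next
    case False
    thus ?thesis using less that by simp
  qed
  hence "(\<Sum>j<m. of_nat (Suc m choose j) * shifted_power_sum p x j) = 0"
    by (intro sum.neutral) blast
  moreover have "(\<Sum>j\<le>m. of_nat (Suc m choose j) * shifted_power_sum p x j) = 0"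
    by (rule shifted_power_sum_recurrence) (use assms(2) of_nat_CHAR[where ?'a = 'a] in simp)
  ultimately have "of_nat (Suc m) * shifted_power_sum p x m = 0"
    by (simp flip: lessThan_Suc_atMost)
  moreover have "\<not> p dvd Suc m"
  proof
    assume "p dvd Suc m"
    then obtain q where q: "Suc m = p * q" by (auto elim: dvdE)
    hence "p * q < p * 2" using less.prems(1) by linarith
    hence "q = 0 \<or> q = 1" by auto
    thus False using q less.prems(2) by auto
  qed
  hence "of_nat (Suc m) \<noteq> (0 :: 'a)"
    using assms(2) by (simp add: of_nat_eq_0_iff_char_dvd del: of_nat_Suc)
  ultimately show ?case by simp
qed

text \<open>In the expansion by powers of \<open>x\<close>, every term but the top one has a
  vanishing power sum or, for \<open>j = p - 1\<close>, a coefficient divisible by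
  \<open>p\<close>.\<close>

lemma shifted_power_sum_const:
  fixes x :: "'a::field"
  assumes "prime p" "CHAR('a) = p" "m \<le> 2 * p - 2"
  shows "shifted_power_sum p x m = shifted_power_sum p 0 m"
proof -
  have "shifted_power_sum p x m = (\<Sum>i<p. \<Sum>j\<le>m. of_nat (m choose j) * of_nat i ^ j * x ^ (m - j))"
    unfolding shifted_power_sum_def by (simp add: binomial_ring add.commute[of x])
  also have "\<dots> = (\<Sum>j\<le>m. of_nat (m choose j) * x ^ (m - j) * shifted_power_sum p 0 j)"
    unfolding shifted_power_sum_def by (subst sum.swap) (simp add: sum_distrib_left mult_ac)
  also have "\<dots> = (\<Sum>j\<in>{m}. of_nat (m choose j) * x ^ (m - j) * shifted_power_sum p 0 j)"
  proof (intro sum.mono_neutral_right ballI)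
    fix j assume j: "j \<in> {..m} - {m}"
    show "of_nat (m choose j) * x ^ (m - j) * shifted_power_sum p 0 j = 0"
    proof (cases "j = p - 1")
      case True
      with j have "p \<le> m" by auto
      hence "p dvd (m choose j)"
        unfolding True using assms by (intro prime_dvd_choose_pred)
      thus ?thesis using assms(2) by (simp add: of_nat_eq_0_iff_char_dvd)
    next
      case False
      thus ?thesis using j assms by (simp add: shifted_power_sum_eq_0)
    qed
  qed auto
  finally show ?thesis by simp
qed

text \<open>By Fermat each nonzero residue contributes 1, which gives \<open>p - 1\<close>, that is,
  -1.\<close>

lemma shifted_power_sum_pred_neq_0:
  assumes "prime p" "CHAR('a::field) = p"
  shows "shifted_power_sum p (0 :: 'a) (p - 1) \<noteq> 0"
proof -
  have p: "p \<ge> 2" using assms(1) by (rule prime_ge_2_nat)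
  have one: "(of_nat i :: 'a) ^ (p - 1) = 1" if "i \<in> {1..<p}" for i
  proof -
    have "(of_nat i :: 'a) ^ (p - 1) * of_nat i = of_nat i"
      using of_nat_power_CHAR[where ?'a = 'a] assms p by (simp flip: power_Suc2)
    moreover have "of_nat i \<noteq> (0 :: 'a)"
      using that assms(2) by (auto simp: of_nat_eq_0_iff_char_dvd dest: dvd_imp_le)
    ultimately show ?thesis by simp
  qed
  have "shifted_power_sum p (0 :: 'a) (p - 1) = (\<Sum>i\<in>insert 0 {1..<p}. of_nat i ^ (p - 1))"
    unfolding shifted_power_sum_def using p by (intro sum.cong) auto
  also have "\<dots> = of_nat (p - 1)"
    using one p by (subst sum.insert) (simp_all add: power_0_left)
  also have "\<dots> \<noteq> 0"
    using p assms(2) by (auto simp: of_nat_eq_0_iff_char_dvd dest: dvd_imp_le)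
  finally show ?thesis .
qed

lemma sum_mult_shifted_powers:
  fixes x z :: "'a::field"
  assumes "prime p" "CHAR('a) = p" "k < p" "p \<le> k + l" "k + l \<le> 2 * p - 2"
  shows "(\<Sum>i<p. (x + of_nat i) ^ k * (x + z + of_nat i) ^ l)
    = of_nat (l choose (p - 1 - k)) * z ^ (k + l - (p - 1)) * shifted_power_sum p 0 (p - 1)
      + shifted_power_sum p 0 (k + l)"
proof -
  have "(\<Sum>i<p. (x + of_nat i) ^ k * (x + z + of_nat i) ^ l)
      = (\<Sum>i<p. (x + of_nat i) ^ k * ((x + of_nat i) + z) ^ l)"
    by (simp add: algebra_simps)
  also have "\<dots> = (\<Sum>i<p. \<Sum>j\<le>l. of_nat (l choose j) * z ^ (l - j) * (x + of_nat i) ^ (k + j))"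
    by (simp add: binomial_ring[of "x + of_nat _" z] sum_distrib_left power_add mult_ac)
  also have "\<dots> = (\<Sum>j\<le>l. of_nat (l choose j) * z ^ (l - j) * shifted_power_sum p x (k + j))"
    unfolding shifted_power_sum_def sum_distrib_left by (rule sum.swap)
  also have "\<dots> = (\<Sum>j\<le>l. of_nat (l choose j) * z ^ (l - j) * shifted_power_sum p 0 (k + j))"
  proof (rule sum.cong)
    fix j assume "j \<in> {..l}"
    hence "k + j \<le> 2 * p - 2" using assms(5) by simp
    thus "of_nat (l choose j) * z ^ (l - j) * shifted_power_sum p x (k + j)
        = of_nat (l choose j) * z ^ (l - j) * shifted_power_sum p 0 (k + j)"
      by (simp add: shifted_power_sum_const[OF assms(1,2), of _ x])
  qed simp
  also have "\<dots> = (\<Sum>j\<in>{p - 1 - k, l}.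
      of_nat (l choose j) * z ^ (l - j) * shifted_power_sum p 0 (k + j))"
  \<comment> \<open>Only the exponents \<open>p - 1\<close> and \<open>k + l\<close> survive: for
    \<open>j < l\<close> the exponent \<open>k + j\<close> stays below \<open>2 * p - 2\<close>. The
    two indices differ because \<open>p \<le> k + l\<close>.\<close>
  proof (intro sum.mono_neutral_right ballI)
    fix j assume "j \<in> {..l} - {p - 1 - k, l}"
    hence "k + j < 2 * p - 2" "k + j \<noteq> p - 1" using assms by auto
    thus "of_nat (l choose j) * z ^ (l - j) * shifted_power_sum p 0 (k + j) = 0"
      by (simp add: shifted_power_sum_eq_0[OF assms(1,2)])
  qed (use assms in auto)
  also have "\<dots> = of_nat (l choose (p - 1 - k)) * z ^ (l - (p - 1 - k)) * shifted_power_sum p 0 (k + (p - 1 - k))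
      + shifted_power_sum p 0 (k + l)"
    using assms by (subst sum.insert) auto
  also have "l - (p - 1 - k) = k + l - (p - 1)" using assms by simp
  also have "k + (p - 1 - k) = p - 1" using assms by simp
  finally show ?thesis .
qed

section \<open>Sums of monomials over shifts and a GAPN criterion\<close>

text \<open>Frobenius fixes \<open>of_nat i\<close>, so it moves \<open>y + of_nat i\<close> by
  \<open>y ^ p - y\<close>, whatever \<open>i\<close> is. This turns the base-\<open>p\<close>
  digits \<open>k\<close> and \<open>l\<close> into the exponents of
  \<open>sum_mult_shifted_powers\<close>.\<close>

lemma sum_monomial_shifts:
  fixes a y :: "'a::field"
  assumes "prime p" "CHAR('a) = p" "k < p" "p \<le> k + l" "k + l \<le> 2 * p - 2"
  shows "(\<Sum>i<p. (a * y + of_nat i * a) ^ (k + l * p))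
    = a ^ (k + l * p) * (of_nat (l choose (p - 1 - k)) * (y ^ p - y) ^ (k + l - (p - 1))
        * shifted_power_sum p 0 (p - 1) + shifted_power_sum p 0 (k + l))"
proof -
  have pc: "prime CHAR('a)" using assms(1,2) by simp
  have "(a * y + of_nat i * a) ^ (k + l * p)
      = a ^ (k + l * p) * ((y + of_nat i) ^ k * (y + (y ^ p - y) + of_nat i) ^ l)" for i
  proof -
    have "(a * y + of_nat i * a) ^ (k + l * p) = (a * (y + of_nat i)) ^ (k + l * p)"
      by (simp add: algebra_simps)
    also have "\<dots> = a ^ (k + l * p) * ((y + of_nat i) ^ k * ((y + of_nat i) ^ p) ^ l)"
      by (simp add: power_mult_distrib power_add mult.commute[of l p] power_mult)
    also have "(y + of_nat i) ^ p = y + (y ^ p - y) + of_nat i"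
      using freshmans_dream[OF pc, of p y "of_nat i"] of_nat_power_CHAR[OF pc, of i] assms(2) by simp
    finally show ?thesis .
  qed
  thus ?thesis
    by (simp only: sum_mult_shifted_powers[OF assms] flip: sum_distrib_left)
qed

lemma card_artin_schreier_fibre_le:
  fixes b :: "'a::field"
  assumes "p \<ge> 2"
  shows "finite {y. y ^ p - y = b}" "card {y. y ^ p - y = b} \<le> p"
proof -
  define P where "P = monom 1 p + [:- b, - 1:]"
  have deg: "degree P = p"
    unfolding P_def using assms by (subst degree_add_eq_left) (auto simp: degree_monom_eq)
  hence "P \<noteq> 0" using assms by auto
  moreover have "{y. y ^ p - y = b} = {y. poly P y = 0}"
    by (auto simp: P_def poly_monom algebra_simps)
  ultimately show "finite {y. y ^ p - y = b}" "card {y. y ^ p - y = b} \<le> p"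
    using card_poly_roots_bound[of P] poly_roots_finite[of P] deg by simp_all
qed

text \<open>After scaling by \<open>a\<close>, all solutions for a given \<open>b\<close> lie in one
  fibre of \<open>y ^ p - y\<close>, which has at most \<open>p\<close> elements.\<close>

lemma gapnI:
  fixes G :: "'a::{field, finite} \<Rightarrow> 'a"
  assumes "p \<ge> 2"
    and inj: "\<And>a x y. a \<noteq> 0 \<Longrightarrow>
      (\<Sum>i<p. G (a * x + of_nat i * a)) = (\<Sum>i<p. G (a * y + of_nat i * a)) \<Longrightarrow>
      x ^ p - x = y ^ p - y"
  shows "gapn p G"
  unfolding gapn_def
proof (intro allI impI)
  fix a b :: 'a assume a: "a \<noteq> 0"
  let ?S = "{x. (\<Sum>i<p. G (x + of_nat i * a)) = b}"
  show "card ?S \<le> p"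
  proof (cases "?S = {}")
    case False
    then obtain x where x: "x \<in> ?S" by blast
    let ?F = "{y. y ^ p - y = (x / a) ^ p - x / a}"
    have "?S \<subseteq> (*) a ` ?F"
    proof
      fix y assume y: "y \<in> ?S"
      have "(y / a) ^ p - y / a = (x / a) ^ p - x / a"
        by (rule inj[OF a]) (use x y a in simp)
      thus "y \<in> (*) a ` ?F"
        using a by (intro image_eqI[of _ _ "y / a"]) auto
    qed
    hence "card ?S \<le> card ((*) a ` ?F)"
      by (intro card_mono) simp_all
    also have "\<dots> \<le> card ?F"
      by (rule card_image_le) simp
    also have "\<dots> \<le> p"
      using assms(1) by (rule card_artin_schreier_fibre_le)
    finally show ?thesis .
  qed simp
qed

section \<open>Exponents and digit sums\<close>

lemma poly_exponents_binomial:
  fixes c :: "'a::{field, finite}"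
  assumes "u \<noteq> v" "u < CARD('a)" "v < CARD('a)" "c \<noteq> 0"
  shows "poly_exponents (\<lambda>x :: 'a. x ^ u + c * x ^ v) = {u, v}"
proof -
  let ?P = "monom 1 u + monom c v"
  have "fun_poly (\<lambda>x :: 'a. x ^ u + c * x ^ v) = ?P"
    unfolding fun_poly_def
  proof (rule the1_equality[OF ex1_fun_poly], intro conjI allI)
    show "degree ?P \<le> CARD('a) - 1"
      using assms by (intro degree_add_le order_trans[OF degree_monom_le]) auto
  qed (simp add: poly_monom)
  thus ?thesis
    using assms by (auto simp: poly_exponents_def)
qed

lemma digit_sum_two_digits:
  assumes "k < p" "l < p" "l > 0"
  shows "digit_sum p (k + l * p) = k + l"
proof -
  have "(k + l * p) div p ^ i mod p = 0" if "i \<notin> {0, 1}" for i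
  proof -
    have "k + l * p < Suc l * p" using assms by simp
    also have "\<dots> \<le> p * p" using assms by (intro mult_right_mono) auto
    also have "\<dots> = p ^ 2" by (simp add: power2_eq_square)
    also have "\<dots> \<le> p ^ i" using that assms by (intro power_increasing) auto
    finally show ?thesis by simp
  qed
  \<comment> \<open>Since \<open>l > 0\<close>, position 1 lies in the summation range of
    \<open>digit_sum\<close>.\<close>
  hence "digit_sum p (k + l * p) = (\<Sum>i\<in>{0, 1}. (k + l * p) div p ^ i mod p)"
    unfolding digit_sum_def using assms
    by (intro sum.mono_neutral_right) (auto simp: Suc_le_eq)
  thus ?thesis using assms by simp
qed

section \<open>Choice of the coefficient and of the digits\<close>

text \<open>The polynomial \<open>X^n - 1\<close> has at most \<open>n\<close> roots, fewer than
  there are nonzero elements.\<close>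

lemma exists_power_neq_1:
  fixes n :: nat
  assumes "n > 0" "n < CARD('a::{field, finite}) - 1"
  obtains c :: "'a::{field, finite}" where "c \<noteq> 0" "c ^ n \<noteq> 1"
proof -
  let ?P = "monom 1 n + [:- 1:] :: 'a poly"
  have "degree ?P = n"
    using assms by (subst degree_add_eq_left) (auto simp: degree_monom_eq)
  moreover from this have "?P \<noteq> 0" using assms(1) by (metis degree_0 less_irrefl)
  ultimately have "card {x :: 'a. x ^ n = 1} \<le> n"
    using card_poly_roots_bound[of ?P] by (simp add: poly_monom)
  also have "n < card (UNIV - {0 :: 'a})" using assms(2) by simp
  finally have "\<not> UNIV - {0} \<subseteq> {x :: 'a. x ^ n = 1}"
    by (meson card_mono finite leD)
  thus thesis using that by auto
qed

text \<open>Here \<open>r\<close> is the odd part of \<open>p + 1\<close> and \<open>h\<close> its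
  power of 2; \<open>r = 1\<close> would make \<open>p\<close> a Mersenne prime.\<close>

lemma odd_factor_if_not_mersenne:
  assumes "prime p" "odd p" "\<not> mersenne_prime p"
  obtains r h where "odd r" "r > 1" "even h" "p + 1 = r * h"
proof -
  obtain r where r: "p + 1 = 2 ^ multiplicity 2 (p + 1) * r" "\<not> 2 dvd r"
    by (rule multiplicity_decompose'[of "p + 1" 2]) auto
  have "multiplicity 2 (p + 1) \<noteq> 0"
    using r assms(2) by (metis even_plus_one_iff mult_1 power_0)
  moreover have "r \<noteq> 1"
  proof
    assume "r = 1"
    hence "p = 2 ^ multiplicity 2 (p + 1) - 1" using r(1) by simp
    thus False using assms(1,3) unfolding mersenne_prime_def by blast
  qed
  moreover have "r > 0" using r by (auto intro: Nat.gr0I)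
  ultimately show thesis
    using r by (intro that[of r "2 ^ multiplicity 2 (p + 1)"]) (auto simp: mult.commute)
qed

lemma exists_dvd_double_add:
  fixes r n :: nat
  assumes "odd r"
  obtains k where "0 < k" "k \<le> r" "r dvd 2 * k + n"
proof -
  define s where "s = n mod r"
  have r: "r > 0" using assms by (rule odd_pos)
  hence s: "s < r" by (simp add: s_def)
  have n: "n = s + r * (n div r)" by (simp add: s_def)
  show thesis
  \<comment> \<open>As \<open>r\<close> is odd, one of \<open>r - s\<close> and
    \<open>2 * r - s\<close> is even; both are congruent to \<open>- n\<close> modulo
    \<open>r\<close>, so half of the even one serves as \<open>k\<close>.\<close>
  proof (cases "even (r - s)")
    case True
    hence "2 * ((r - s) div 2) + n = r * (1 + n div r)"
      using s n by (simp add: algebra_simps)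
    moreover have "0 < (r - s) div 2" using True s by presburger
    ultimately show thesis by (intro that[of "(r - s) div 2"]) auto
  next
    case False
    hence "even (2 * r - s)" using s assms by auto
    hence "2 * ((2 * r - s) div 2) + n = r * (2 + n div r)"
      using s n by (simp add: algebra_simps)
    moreover have "0 < (2 * r - s) div 2" using s by auto
    ultimately show thesis by (intro that[of "(2 * r - s) div 2"]) auto
  qed
qed

section \<open>Construction of the binomial\<close>

theorem corollary3:
  fixes p d :: nat
  assumes "prime p" and "odd p" and "\<not> mersenne_prime p"
    and "CARD('a::{field, finite}) = p ^ 2"
    and "even d" and "p \<le> d" and "d \<le> 2 * (p - 1)"
  shows "\<exists>G :: 'a \<Rightarrow> 'a. gapn p G \<and> is_binomial G \<and> algebraic_degree p G = d"
proof -
  have CHAR: "CHAR('a) = p"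
    using assms(1,4) by (rule CHAR_eq_if_card_eq_prime_power)
  hence prime_CHAR: "prime CHAR('a)" using assms(1) by simp
  have p: "p \<ge> 3"
    using prime_ge_2_nat[OF assms(1)] assms(2) by (cases "p = 2") auto
  define e where "e = d - (p - 1)"
  have e: "even e" "0 < e" "1 < e" "e < p" "d = (p - 1) + e"
  proof -
    show "even e" using assms(2,5,6) unfolding e_def by auto
    moreover show "0 < e" using assms(6) p unfolding e_def by linarith
    ultimately show "1 < e" by (auto elim!: evenE)
    show "e < p" "d = (p - 1) + e" using assms(6,7) p unfolding e_def by linarith+
  qed
  obtain r h where r: "odd r" "r > 1" and h: "even h" and rh: "p + 1 = r * h"
    using odd_factor_if_not_mersenne[OF assms(1-3)] by blast
  have h2: "h \<ge> 2" using h rh by (cases "h = 0"; cases "h = 1") auto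
  \<comment> \<open>Modulo \<open>p + 1\<close> one has \<open>p = -1\<close>, so
    \<open>v - u\<close> is congruent to \<open>2 * k + (e + 3)\<close> for the exponents chosen
    below.\<close>
  obtain k where k: "0 < k" "k \<le> r" "r dvd 2 * k + (e + 3)"
    using exists_dvd_double_add[OF r(1)] by blast
  have "r * 2 \<le> r * h" using h2 by simp
  with rh k p have kp: "k < p" by linarith
  \<comment> \<open>The digit sums are \<open>d\<close> and \<open>p\<close>, so
    \<open>y ^ p - y\<close> enters with exponents \<open>e\<close> and 1 respectively.\<close>
  define u v where "u = (p - 1) + e * p" and "v = k + (p - k) * p"
  define N where "N = (p - 1) * h"
  have "N > 0" using p h2 by (simp add: N_def)
  have Nr: "N * r = CARD('a) - 1"
  proof -
    have "N * r = (p - 1) * (p + 1)" by (simp only: N_def rh mult_ac)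
    also have "\<dots> = CARD('a) - 1"
      using p by (simp add: assms(4) algebra_simps power2_eq_square)
    finally show ?thesis .
  qed
  have "N * 1 < N * r" using r(2) \<open>N > 0\<close> by (intro mult_strict_left_mono) auto
  then obtain c :: 'a where c: "c \<noteq> 0" "c ^ N \<noteq> 1"
    using exists_power_neq_1[OF \<open>N > 0\<close>] Nr by auto
  \<comment> \<open>The order of \<open>a ^ N\<close> divides \<open>r\<close>, which divides the
    difference of \<open>u\<close> and \<open>v\<close>.\<close>
  have powers: "(a ^ v) ^ N = (a ^ u) ^ N" if "a \<noteq> 0" for a :: 'a
  proof -
    obtain q where q: "2 * k + (e + 3) = r * q" using k(3) by (auto elim: dvdE)
    have "k * p + (p - k) * p = p * p" using kp by (simp flip: distrib_right)
    \<comment> \<open>The congruence modulo \<open>p + 1\<close>, with multiples added on both sides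
      to avoid subtraction.\<close>
    hence "v + (p + 1) * (k + e + 2) = u + (2 * k + (e + 3)) + (p + 1) * p"
      using p by (simp add: u_def v_def algebra_simps)
    hence eq: "v + r * (h * (k + e + 2)) = u + r * (q + h * p)"
      by (simp only: rh q mult.assoc distrib_left add.assoc)
    have "(a ^ N) ^ r = 1"
      using power_card_minus_1_eq_1[OF that] Nr by (simp flip: power_mult)
    hence one: "(a ^ N) ^ (r * t) = 1" for t by (simp add: power_mult)
    have "(a ^ N) ^ v = (a ^ N) ^ (v + r * (h * (k + e + 2)))"
      by (simp add: power_add one)
    also have "\<dots> = (a ^ N) ^ u"
      by (simp only: eq) (simp add: power_add one)
    finally show ?thesis by (simp add: mult.commute flip: power_mult)
  qed
  \<comment> \<open>Such \<open>w\<close> satisfy \<open>w ^ (p - 1) = 1\<close> or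
    \<open>w ^ (p - 1) = - 1\<close>, and the even exponent \<open>h\<close> removes the
    sign.\<close>
  have pow_N: "w ^ N = 1" if "w \<noteq> 0" "w ^ p = w \<or> w ^ p = - w" for w :: 'a
  proof -
    have "w ^ (p - 1) * w = w ^ p" using p by (simp flip: power_Suc2)
    with that have "w ^ (p - 1) = 1 \<or> w ^ (p - 1) = - 1"
      by (metis mult_cancel_right mult_1 mult_minus1)
    thus ?thesis using h by (auto simp: N_def power_mult)
  qed
  define G where "G = (\<lambda>x :: 'a. x ^ u + c * x ^ v)"
  define s where "s = shifted_power_sum p (0 :: 'a) (p - 1)"
  define m where "m = (p - k) choose (p - 1 - k)"
  have "m = p - k" using kp binomial_symmetric[of 1 "p - k"] by (simp add: m_def)
  hence "0 < m" "m < p" using k(1) kp by auto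
  hence m: "of_nat m \<noteq> (0 :: 'a)"
    using CHAR by (simp add: of_nat_eq_0_iff_char_dvd nat_dvd_not_less)
  have "gapn p G"
  proof (rule gapnI)
    show "p \<ge> 2" using p by simp
  next
    fix a x y :: 'a
    assume a: "a \<noteq> 0"
      and eq: "(\<Sum>i<p. G (a * x + of_nat i * a)) = (\<Sum>i<p. G (a * y + of_nat i * a))"
    define f where "f x = x ^ p - x" for x :: 'a
    \<comment> \<open>These constants do not involve the point and cancel when two sums are
      compared.\<close>
    define t t' where "t = shifted_power_sum p (0 :: 'a) (p - 1 + e)"
      and "t' = shifted_power_sum p (0 :: 'a) p"
    have sum_G: "(\<Sum>i<p. G (a * x + of_nat i * a))
        = a ^ u * (f x ^ e * s + t) + c * (a ^ v * (of_nat m * f x * s + t'))" for x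
    proof -
      have "(\<Sum>i<p. (a * x + of_nat i * a) ^ u) = a ^ u * (f x ^ e * s + t)"
        unfolding u_def f_def s_def t_def
        by (subst sum_monomial_shifts[OF assms(1) CHAR]) (use e p in auto)
      moreover have "(\<Sum>i<p. (a * x + of_nat i * a) ^ v) = a ^ v * (of_nat m * f x * s + t')"
        unfolding v_def f_def s_def t'_def m_def
        by (subst sum_monomial_shifts[OF assms(1) CHAR]) (use kp p in auto)
      ultimately show ?thesis
        by (simp add: G_def sum.distrib flip: sum_distrib_left)
    qed
    \<comment> \<open>Applying Frobenius twice is the identity on a field with \<open>p ^ 2\<close>
      elements, so it swaps the two terms of \<open>f x\<close>.\<close>
    have f: "f x ^ p = - f x" for x
    proof -
      have "x ^ CARD('a) = x"
      proof (cases "x = 0")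
        case False
        thus ?thesis
          using power_card_minus_1_eq_1[OF False] by (simp add: power_eq_if[of x "CARD('a)"])
      qed simp
      hence "(x ^ p) ^ p = x"
        by (simp add: assms(4) power2_eq_square flip: power_mult)
      moreover have "(x ^ p + - x) ^ p = (x ^ p) ^ p + (- x) ^ p"
        by (rule freshmans_dream) (use prime_CHAR CHAR in simp_all)
      ultimately show ?thesis using assms(2) by (simp add: f_def)
    qed
    have diff: "(w - w') ^ p = w ^ p - w' ^ p" for w w' :: 'a
      using freshmans_dream[OF prime_CHAR, of p w "- w'"] assms(2) CHAR by simp
    show "x ^ p - x = y ^ p - y"
    proof (rule ccontr)
      assume neq: "x ^ p - x \<noteq> y ^ p - y"
      define w E where "w = f x - f y" and "E = f y ^ e - f x ^ e"
      have w: "w \<noteq> 0" "w ^ p = - w"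
        using neq by (simp_all add: w_def f_def[symmetric] diff f)
      \<comment> \<open>The sign from Frobenius disappears because \<open>e\<close> is even.\<close>
      have "(f x ^ e) ^ p = f x ^ e" for x
      proof -
        have "(f x ^ e) ^ p = (f x ^ p) ^ e" by (simp add: mult.commute flip: power_mult)
        thus ?thesis using e(1) by (simp add: f)
      qed
      hence E: "E ^ p = E" by (simp add: E_def diff)
      have "s * (c * of_nat m * a ^ v * w - a ^ u * E) = 0"
        using eq unfolding sum_G w_def E_def by (simp add: algebra_simps)
      moreover have "s \<noteq> 0"
        unfolding s_def using assms(1) CHAR by (rule shifted_power_sum_pred_neq_0)
      ultimately have key: "c * of_nat m * a ^ v * w = a ^ u * E" by simp
      have "E \<noteq> 0" using key c(1) m a w(1) by auto
      \<comment> \<open>In the \<open>N\<close>-th power of \<open>key\<close>, the factors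
        \<open>of_nat m\<close>, \<open>w\<close> and \<open>E\<close> become 1 and the powers of
        \<open>a\<close> agree, which forces \<open>c ^ N = 1\<close>.\<close>
      have "c ^ N * of_nat m ^ N * (a ^ v) ^ N * w ^ N = (a ^ u) ^ N * E ^ N"
        using arg_cong[OF key, of "\<lambda>z. z ^ N"] by (simp add: power_mult_distrib)
      moreover have "of_nat m ^ N = (1 :: 'a)"
        using of_nat_power_CHAR[OF prime_CHAR, of m] m CHAR by (intro pow_N) auto
      ultimately have "c ^ N * (a ^ u) ^ N = (a ^ u) ^ N"
        using pow_N[of w] pow_N[of E] w E \<open>E \<noteq> 0\<close> powers[OF a] by simp
      thus False using a c(2) by simp
    qed
  qed
  moreover have digits: "digit_sum p u = d" "digit_sum p v = p"
    unfolding u_def v_def using e k(1) kp p by (subst digit_sum_two_digits; simp)+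
  \<comment> \<open>The digit sums differ since \<open>e > 1\<close> gives \<open>d > p\<close>;
    hence \<open>d\<close> is also their maximum.\<close>
  have "u \<noteq> v" using digits e p by auto
  have two_digits: "i + j * p < CARD('a)" if "i < p" "j < p" for i j
  proof -
    have "i + j * p < Suc j * p" using that by simp
    also have "\<dots> \<le> p * p" using that by (intro mult_right_mono) auto
    finally show ?thesis by (simp add: assms(4) power2_eq_square)
  qed
  have "poly_exponents G = {u, v}"
    unfolding G_def
  proof (rule poly_exponents_binomial)
    show "u < CARD('a)" unfolding u_def by (rule two_digits) (use p e in simp_all)
    show "v < CARD('a)" unfolding v_def by (rule two_digits) (use kp k(1) in simp_all)
  qed fact+
  ultimately show ?thesis
    using \<open>u \<noteq> v\<close> digits assms(6)
    by (intro exI[of _ G]) (simp add: is_binomial_def algebraic_degree_def)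
qed

end
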